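(* For every $n\ge 1$, $|M_n|=3^{\frac{3^n-1}{2}}\,2^{3^{n-1}}$.
   Context: Let $X=\{0,1,2\}$ and let $\mathcal T$ be the rooted ternary tree whose vertices are the finite words over $X$ (the children of $w$ are $w0,w1,w2$); $\mathcal T_n$ is the tree truncated at level $n$, with $\mathrm{Aut}(\mathcal T_1)=S_3$. Automorphisms act on the right, written $(w)\sigma$, and $\sigma\tau$ means first $\sigma$ then $\tau$. For $n\ge2$ every $\sigma\in\mathrm{Aut}(\mathcal T_n)$ is written uniquely as $\sigma=(\sigma_0,\sigma_1,\sigma_2)\pi$ with $\pi\in S_3$, $\sigma_i\in\mathrm{Aut}(\mathcal T_{n-1})$, meaning $(iw)\sigma=((i)\pi)((w)\sigma_i)$; hence $(\sigma_0,\sigma_1,\sigma_2)\pi\cdot(\tau_0,\tau_1,\tau_2)\rho=(\sigma_0\tau_{(0)\pi},\sigma_1\tau_{(1)\pi},\sigma_2\tau_{(2)\pi})\pi\rho$; write $(\sigma_0,\sigma_1,\sigma_2)$ when $\pi=\mathrm{id}$. $\mathrm{Aut}(\mathcal T_{n-1})$ is embedded in $\mathrm{Aut}(\mathcal T_n)$ via $\sigma\mapsto(\sigma,\mathrm{id},\mathrm{id})$. Define $x_1=(0,1,2)$, $y_1=(0,1)$, $z_1=\mathrm{id}$, and for $n\ge2$: $x_n=(\mathrm{id},\mathrm{id},x_{n-1})(0,1,2)$, $y_n=(\mathrm{id},y_{n-1},x_{n-1})(0,1)$, $z_n=(y_{n-1},y_{n-1},x_{n-1})$. Let $L_1=\langle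 x_1\rangle$, $M_1=S_3$, and for $n\ge2$: $L_n=\langle x_n,z_n,L_{n-1}\rangle$, $M_n=\langle x_n,y_n,z_n,L_{n-1}\rangle\le\mathrm{Aut}(\mathcal T_n)$. *)

theory Defs
  imports "HOL-Algebra.Generated_Groups" "HOL-Combinatorics.Cycles"
begin

definition X :: "nat set" where
  "X = {0, 1, 2}"

definition tree_verts :: "nat \<Rightarrow> nat list set" where
  "tree_verts n = {w. set w \<subseteq> X \<and> length w \<le> n}"

definition is_child :: "nat list \<Rightarrow> nat list \<Rightarrow> bool" where
  "is_child v w \<longleftrightarrow> (\<exists>i\<in>X. w = v @ [i])"

text \<open>The group \<open>Aut(T\<^sub>n)\<close>. An automorphism is represented by a function that is the identity
  outside the vertex set. Automorphisms act on the right, so the product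
  of \<open>\<sigma>\<close> and \<open>\<tau>\<close> applies \<open>\<sigma>\<close> first.\<close>

definition tree_aut :: "nat \<Rightarrow> (nat list \<Rightarrow> nat list) monoid" where
  "tree_aut n =
    \<lparr>carrier = {\<sigma>. \<sigma> permutes tree_verts n \<and> \<sigma> [] = [] \<and>
       (\<forall>v\<in>tree_verts n. \<forall>w\<in>tree_verts n. is_child v w \<longleftrightarrow> is_child (\<sigma> v) (\<sigma> w))},
     monoid.mult = (\<lambda>\<sigma> \<tau>. \<tau> \<circ> \<sigma>),
     one = id\<rparr>"

text \<open>\<open>node n \<sigma>\<^sub>0 \<sigma>\<^sub>1 \<sigma>\<^sub>2 \<pi>\<close> is the element \<open>(\<sigma>\<^sub>0, \<sigma>\<^sub>1, \<sigma>\<^sub>2)\<pi>\<close> of \<open>Aut(T\<^sub>n)\<close>, where the \<open>\<sigma>\<^sub>i\<close> are in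
  \<open>Aut(T\<^sub>n\<^sub>-\<^sub>1)\<close>. For \<open>n = 1\<close> and \<open>\<sigma>\<^sub>i = id\<close> it identifies \<open>\<pi> \<in> S\<^sub>3\<close> with an element of \<open>Aut(T\<^sub>1)\<close>.\<close>

definition node :: "nat \<Rightarrow> (nat list \<Rightarrow> nat list) \<Rightarrow> (nat list \<Rightarrow> nat list) \<Rightarrow> (nat list \<Rightarrow> nat list)
    \<Rightarrow> (nat \<Rightarrow> nat) \<Rightarrow> nat list \<Rightarrow> nat list" where
  "node n \<sigma>\<^sub>0 \<sigma>\<^sub>1 \<sigma>\<^sub>2 \<pi> w =
    (if w \<in> tree_verts n
     then (case w of [] \<Rightarrow> [] | i # u \<Rightarrow> \<pi> i # ([\<sigma>\<^sub>0, \<sigma>\<^sub>1, \<sigma>\<^sub>2] ! i) u)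
     else w)"

definition embed :: "nat \<Rightarrow> (nat list \<Rightarrow> nat list) \<Rightarrow> nat list \<Rightarrow> nat list" where
  "embed n \<sigma> = node n \<sigma> id id id"

text \<open>The families below are indexed by \<open>n \<ge> 1\<close>; the values at \<open>0\<close> are dummies that the other
  equations do not use.\<close>

fun x_gen :: "nat \<Rightarrow> nat list \<Rightarrow> nat list" where
  "x_gen 0 = id"
| "x_gen (Suc 0) = node 1 id id id (cycle_of_list [0, 1, 2])"
| "x_gen (Suc (Suc n)) = node (Suc (Suc n)) id id (x_gen (Suc n)) (cycle_of_list [0, 1, 2])"

fun y_gen :: "nat \<Rightarrow> nat list \<Rightarrow> nat list" where
  "y_gen 0 = id"
| "y_gen (Suc 0) = node 1 id id id (cycle_of_list [0, 1])"
| "y_gen (Suc (Suc n)) =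
     node (Suc (Suc n)) id (y_gen (Suc n)) (x_gen (Suc n)) (cycle_of_list [0, 1])"

fun z_gen :: "nat \<Rightarrow> nat list \<Rightarrow> nat list" where
  "z_gen 0 = id"
| "z_gen (Suc 0) = id"
| "z_gen (Suc (Suc n)) =
     node (Suc (Suc n)) (y_gen (Suc n)) (y_gen (Suc n)) (x_gen (Suc n)) id"

fun L :: "nat \<Rightarrow> (nat list \<Rightarrow> nat list) set" where
  "L 0 = {id}"
| "L (Suc 0) = generate (tree_aut 1) {x_gen 1}"
| "L (Suc (Suc n)) = generate (tree_aut (Suc (Suc n)))
     ({x_gen (Suc (Suc n)), z_gen (Suc (Suc n))} \<union> embed (Suc (Suc n)) ` L (Suc n))"

fun M :: "nat \<Rightarrow> (nat list \<Rightarrow> nat list) set" where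
  "M 0 = {id}"
| "M (Suc 0) = carrier (tree_aut 1)"
| "M (Suc (Suc n)) = generate (tree_aut (Suc (Suc n)))
     ({x_gen (Suc (Suc n)), y_gen (Suc (Suc n)), z_gen (Suc (Suc n))} \<union>
      embed (Suc (Suc n)) ` L (Suc n))"

end

theory Submission
  imports Defs
begin

text \<open>
  Call \<open>\<sigma>\<close> even or odd according to the sign of the permutation it induces on the first level.
  For \<open>n \<ge> 2\<close>, \<open>M\<^sub>n\<close> consists exactly of the \<open>(\<sigma>\<^sub>0, \<sigma>\<^sub>1, \<sigma>\<^sub>2)\<pi>\<close> with all \<open>\<sigma>\<^sub>i\<close> in \<open>M\<^sub>n\<^sub>-\<^sub>1\<close> such that the
  product of the signs of the \<open>\<sigma>\<^sub>i\<close> is the sign of \<open>\<pi>\<close>, and \<open>L\<^sub>n\<close> is its even part: conjugating the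
  embedded copy of \<open>L\<^sub>n\<^sub>-\<^sub>1\<close> by \<open>x\<^sub>n\<close> yields all of \<open>(L\<^sub>n\<^sub>-\<^sub>1)\<^sup>3\<close>, the conjugates of \<open>z\<^sub>n\<close> realise every sign
  pattern of product 1, and the powers of \<open>x\<^sub>n\<close> every even \<open>\<pi>\<close>; the odd element \<open>y\<^sub>n\<close> does the rest.
  Each triple in \<open>M\<^sub>n\<^sub>-\<^sub>1\<close> admits three choices of \<open>\<pi>\<close>, so that \<open>|M\<^sub>n| = 3 |M\<^sub>n\<^sub>-\<^sub>1|\<^sup>3\<close>.
\<close>

section \<open>Vertices of the truncated tree and its automorphism group\<close>

lemma finite_X: "finite X" and card_X: "card X = 3"
  by (auto simp: X_def)

lemma nth3_in: "\<lbrakk>i \<in> X; a \<in> C; b \<in> C; c \<in> C\<rbrakk> \<Longrightarrow> [a, b, c] ! i \<in> C"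
  by (auto simp: X_def)

lemma Nil_in_tree_verts [simp]: "[] \<in> tree_verts n"
  by (simp add: tree_verts_def)

lemma Cons_in_tree_verts [simp]: "i # u \<in> tree_verts (Suc n) \<longleftrightarrow> i \<in> X \<and> u \<in> tree_verts n"
  by (auto simp: tree_verts_def)

lemma finite_tree_verts: "finite (tree_verts n)"
  unfolding tree_verts_def by (rule finite_lists_length_le) (rule finite_X)

lemma is_child_Nil [simp]: "\<not> is_child v []" "is_child [] (i # u) \<longleftrightarrow> i \<in> X \<and> u = []"
  by (auto simp: is_child_def)

lemma is_child_Cons [simp]: "is_child (i # u) (j # w) \<longleftrightarrow> i = j \<and> is_child u w"
  by (auto simp: is_child_def)

lemma mult_tree_aut [simp]: "\<sigma> \<otimes>\<^bsub>tree_aut n\<^esub> \<tau> = \<tau> \<circ> \<sigma>"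
  by (simp add: tree_aut_def)

lemma one_tree_aut [simp]: "\<one>\<^bsub>tree_aut n\<^esub> = id"
  by (simp add: tree_aut_def)

lemma carrier_tree_aut_iff:
  "\<sigma> \<in> carrier (tree_aut n) \<longleftrightarrow> \<sigma> permutes tree_verts n \<and> \<sigma> [] = [] \<and>
     (\<forall>v\<in>tree_verts n. \<forall>w\<in>tree_verts n. is_child v w \<longleftrightarrow> is_child (\<sigma> v) (\<sigma> w))"
  by (simp add: tree_aut_def)

lemma tree_autD:
  assumes "\<sigma> \<in> carrier (tree_aut n)"
  shows "\<sigma> permutes tree_verts n" "\<sigma> [] = []"
    "\<And>v w. \<lbrakk>v \<in> tree_verts n; w \<in> tree_verts n\<rbrakk> \<Longrightarrow> is_child (\<sigma> v) (\<sigma> w) \<longleftrightarrow> is_child v w"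
  using assms by (auto simp: carrier_tree_aut_iff)

lemma group_tree_aut: "group (tree_aut n)"
proof (rule groupI)
  fix \<sigma> \<tau> assume "\<sigma> \<in> carrier (tree_aut n)" "\<tau> \<in> carrier (tree_aut n)"
  note * = tree_autD[OF this(1)] tree_autD[OF this(2)]
  show "\<sigma> \<otimes>\<^bsub>tree_aut n\<^esub> \<tau> \<in> carrier (tree_aut n)"
    using * permutes_in_image[OF *(1)]
    by (simp add: carrier_tree_aut_iff permutes_compose)
next
  fix \<sigma> assume \<sigma>: "\<sigma> \<in> carrier (tree_aut n)"
  note p = tree_autD(1)[OF \<sigma>]
  have "Hilbert_Choice.inv \<sigma> \<in> carrier (tree_aut n)"
    unfolding carrier_tree_aut_iff
  proof (intro conjI ballI)
    show "Hilbert_Choice.inv \<sigma> permutes tree_verts n"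
      using p by (rule permutes_inv)
    show "Hilbert_Choice.inv \<sigma> [] = []"
      using tree_autD(2)[OF \<sigma>] permutes_inverses(2)[OF p] by metis
    fix v w assume "v \<in> tree_verts n" "w \<in> tree_verts n"
    then show "is_child v w \<longleftrightarrow> is_child (Hilbert_Choice.inv \<sigma> v) (Hilbert_Choice.inv \<sigma> w)"
      using tree_autD(3)[OF \<sigma>] permutes_inverses(1)[OF p]
        permutes_in_image[OF permutes_inv[OF p]] by metis
  qed
  then show "\<exists>\<tau>\<in>carrier (tree_aut n). \<tau> \<otimes>\<^bsub>tree_aut n\<^esub> \<sigma> = \<one>\<^bsub>tree_aut n\<^esub>"
    using permutes_inv_o(1)[OF p] by auto
qed (simp_all add: carrier_tree_aut_iff o_assoc)

lemma finite_tree_aut: "finite (carrier (tree_aut n))"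
  by (rule finite_subset[OF _ finite_permutations[OF finite_tree_verts[of n]]])
    (auto simp: carrier_tree_aut_iff)

lemma id_in_tree_aut [simp]: "id \<in> carrier (tree_aut n)"
  using group_tree_aut[of n] by (metis group.is_monoid monoid.one_closed one_tree_aut)

text \<open>By cancellation, left multiplication by \<open>a\<close> is injective on the finite set
  \<open>H\<close>, hence onto \<open>H\<close>. Solving \<open>a = a \<otimes> e\<close> puts the
  identity into \<open>H\<close>, and solving \<open>\<one> = a \<otimes> b\<close> puts the inverse
  there. Closure under products is thus all that has to be checked for the groups below.\<close>

lemma (in group) finite_submonoid_subgroup:
  assumes "finite H" "H \<subseteq> carrier G" "H \<noteq> {}"
    and mult: "\<And>a b. \<lbrakk>a \<in> H; b \<in> H\<rbrakk> \<Longrightarrow> a \<otimes> b \<in> H"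
  shows "subgroup H G"
proof (rule subgroupI[OF assms(2,3) _ mult])
  fix a assume a: "a \<in> H"
  have "inj_on ((\<otimes>) a) H"
    using assms(2) a by (intro inj_onI) (metis Units_eq Units_l_cancel subsetD)
  then have surj: "(\<otimes>) a ` H = H"
    using assms(1) mult a by (intro endo_inj_surj) auto
  then obtain e where e: "e \<in> H" "a = a \<otimes> e"
    using a by (metis imageE)
  then have "e = \<one>"
    using a assms(2) by (metis l_cancel_one' subsetD)
  then obtain b where "b \<in> H" "\<one> = a \<otimes> b"
    using surj e by (metis imageE)
  then show "inv a \<in> H"
    using a assms(2) by (metis inv_equality inv_inv inv_closed subsetD)
qed

section \<open>Wreath coordinates\<close>

text \<open>A form of \<open>node\<close> whose coordinates are a function of the letter, so that
  they can be reindexed by a permutation and multiplied over \<open>X\<close>.\<close>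

definition branch :: "nat \<Rightarrow> (nat \<Rightarrow> nat list \<Rightarrow> nat list) \<Rightarrow> (nat \<Rightarrow> nat) \<Rightarrow> nat list \<Rightarrow> nat list" where
  "branch n f \<pi> w =
    (if w \<in> tree_verts n then (case w of [] \<Rightarrow> [] | i # u \<Rightarrow> \<pi> i # f i u) else w)"

lemma node_eq_branch: "node n a b c \<pi> = branch n ((!) [a, b, c]) \<pi>"
  by (rule ext) (simp add: node_def branch_def)

lemma branch_Nil [simp]: "branch n f \<pi> [] = []"
  by (simp add: branch_def)

lemma branch_Cons [simp]:
  "i \<in> X \<Longrightarrow> u \<in> tree_verts n \<Longrightarrow> branch (Suc n) f \<pi> (i # u) = \<pi> i # f i u"
  by (simp add: branch_def)

lemma branch_outside [simp]: "w \<notin> tree_verts n \<Longrightarrow> branch n f \<pi> w = w"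
  by (simp add: branch_def)

lemma tree_verts_Suc_cases:
  assumes "w \<in> tree_verts (Suc n)"
  obtains "w = []" | i u where "w = i # u" "i \<in> X" "u \<in> tree_verts n"
  using assms by (cases w) auto

lemma branch_cong:
  assumes "\<And>i. i \<in> X \<Longrightarrow> f i = g i"
  shows "branch (Suc n) f \<pi> = branch (Suc n) g \<pi>"
proof
  fix w show "branch (Suc n) f \<pi> w = branch (Suc n) g \<pi> w"
    by (cases "w \<in> tree_verts (Suc n)") (auto simp: assms elim!: tree_verts_Suc_cases)
qed

lemma branch_id: "(\<And>i. i \<in> X \<Longrightarrow> f i = id) \<Longrightarrow> branch (Suc n) f id = id"
proof
  fix w assume "\<And>i. i \<in> X \<Longrightarrow> f i = id"
  then show "branch (Suc n) f id w = id w"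
    by (cases "w \<in> tree_verts (Suc n)") (auto elim!: tree_verts_Suc_cases)
qed

lemma branch_in_tree_aut:
  assumes f: "\<And>i. i \<in> X \<Longrightarrow> f i \<in> carrier (tree_aut n)" and \<pi>: "\<pi> permutes X"
  shows "branch (Suc n) f \<pi> \<in> carrier (tree_aut (Suc n))"
proof -
  let ?b = "branch (Suc n) f \<pi>"
  note fp = tree_autD[OF f]
  have f_in: "f i u \<in> tree_verts n \<longleftrightarrow> u \<in> tree_verts n" if "i \<in> X" for i u
    using permutes_in_image[OF fp(1)[OF that]] .
  have f_inj: "f i u = f i v \<longleftrightarrow> u = v" if "i \<in> X" for i u v
    using permutes_inj[OF fp(1)[OF that]] by (auto dest: injD)
  have \<pi>_in: "\<pi> i \<in> X \<longleftrightarrow> i \<in> X" for i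
    using permutes_in_image[OF \<pi>] .
  have \<pi>_inj: "\<pi> i = \<pi> j \<longleftrightarrow> i = j" for i j
    using permutes_inj[OF \<pi>] by (auto dest: injD)
  \<comment> \<open>The children of the root are the words \<open>[i]\<close>; they must go to words
    of length one, hence the tail must be empty before and after.\<close>
  have f_Nil: "f i u = [] \<longleftrightarrow> u = []" if "i \<in> X" for i u
    using f_inj[OF that, of u "[]"] fp(2)[OF that] by simp
  \<comment> \<open>The vertex set is finite, so an injective self-map is a bijection.\<close>
  have "inj_on ?b (tree_verts (Suc n))"
    by (rule inj_onI) (auto simp: \<pi>_inj f_inj elim!: tree_verts_Suc_cases)
  moreover have "?b ` tree_verts (Suc n) \<subseteq> tree_verts (Suc n)"
    by (auto simp: \<pi>_in f_in elim!: tree_verts_Suc_cases)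
  ultimately have "bij_betw ?b (tree_verts (Suc n)) (tree_verts (Suc n))"
    using endo_inj_surj[OF finite_tree_verts] by (simp add: bij_betw_def)
  then have "?b permutes tree_verts (Suc n)"
    by (rule bij_imp_permutes) simp
  moreover have "is_child v w \<longleftrightarrow> is_child (?b v) (?b w)"
    if "v \<in> tree_verts (Suc n)" "w \<in> tree_verts (Suc n)" for v w
    using that
    by (elim tree_verts_Suc_cases) (auto simp: \<pi>_in \<pi>_inj f_Nil fp(3))
  ultimately show ?thesis
    by (simp add: carrier_tree_aut_iff)
qed

text \<open>The wreath product law. \<open>branch (Suc n) f \<pi>\<close> acts first and moves the
  subtree at \<open>i\<close> to the one at \<open>\<pi> i\<close>, where \<open>g (\<pi> i)\<close>
  then acts.\<close>

lemma branch_comp: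
  assumes f: "\<And>i. i \<in> X \<Longrightarrow> f i \<in> carrier (tree_aut n)" and \<pi>: "\<pi> permutes X"
  shows "branch (Suc n) g \<rho> \<circ> branch (Suc n) f \<pi> = branch (Suc n) (\<lambda>i. g (\<pi> i) \<circ> f i) (\<rho> \<circ> \<pi>)"
proof
  fix w
  have "f i u \<in> tree_verts n" if "i \<in> X" "u \<in> tree_verts n" for i u
    using permutes_in_image[OF tree_autD(1)[OF f[OF that(1)]]] that(2) by blast
  then show "(branch (Suc n) g \<rho> \<circ> branch (Suc n) f \<pi>) w =
      branch (Suc n) (\<lambda>i. g (\<pi> i) \<circ> f i) (\<rho> \<circ> \<pi>) w"
    by (cases "w \<in> tree_verts (Suc n)")
      (auto simp: permutes_in_image[OF \<pi>] elim!: tree_verts_Suc_cases)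
qed

text \<open>The value at \<open>i # u\<close> shows both \<open>\<pi> i\<close> and
  \<open>f i u\<close>. Extensionality of \<open>f\<close> and \<open>g\<close> off \<open>X\<close>
  turns agreement on \<open>X\<close> into equality, so that elements can be counted by their
  coordinates.\<close>

lemma branch_inject:
  assumes "f \<in> X \<rightarrow>\<^sub>E carrier (tree_aut n)" "g \<in> X \<rightarrow>\<^sub>E carrier (tree_aut n)"
    and \<pi>: "\<pi> permutes X" "\<rho> permutes X"
    and eq: "branch (Suc n) f \<pi> = branch (Suc n) g \<rho>"
  shows "f = g \<and> \<pi> = \<rho>"
proof
  have at: "\<pi> i = \<rho> i \<and> f i u = g i u" if "i \<in> X" "u \<in> tree_verts n" for i u
    using fun_cong[OF eq, of "i # u"] that by simp
  show "\<pi> = \<rho>"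
  proof
    fix i show "\<pi> i = \<rho> i"
      using at[of i "[]"] permutes_not_in[OF \<pi>(1)] permutes_not_in[OF \<pi>(2)] by (cases "i \<in> X") auto
  qed
  show "f = g"
  proof (rule PiE_ext[OF assms(1,2)], rule ext)
    fix i u assume i: "i \<in> X"
    then have "f i permutes tree_verts n" "g i permutes tree_verts n"
      using assms(1,2) by (auto intro!: tree_autD(1))
    then show "f i u = g i u"
      using at[OF i, of u] by (cases "u \<in> tree_verts n") (simp, metis permutes_not_in)
  qed
qed

section \<open>The action on the first level and its sign\<close>

text \<open>Numbers outside \<open>X\<close> are fixed so that the result permutes \<open>X\<close>
  in the sense of \<open>permutes\<close> and has a \<open>sign\<close>.\<close>

definition top_perm :: "(nat list \<Rightarrow> nat list) \<Rightarrow> nat \<Rightarrow> nat" where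
  "top_perm \<sigma> i = (if i \<in> X then hd (\<sigma> [i]) else i)"

definition top_sign :: "(nat list \<Rightarrow> nat list) \<Rightarrow> int" where
  "top_sign \<sigma> = sign (top_perm \<sigma>)"

lemma top_perm_apply:
  assumes "\<sigma> \<in> carrier (tree_aut (Suc n))" "i \<in> X"
  shows "\<sigma> [i] = [top_perm \<sigma> i]" "top_perm \<sigma> i \<in> X"
proof -
  have "is_child (\<sigma> []) (\<sigma> [i])"
    using tree_autD(3)[OF assms(1), of "[]" "[i]"] assms(2) by simp
  then obtain j where "j \<in> X" "\<sigma> [i] = [j]"
    using tree_autD(2)[OF assms(1)] by (auto simp: is_child_def)
  then show "\<sigma> [i] = [top_perm \<sigma> i]" "top_perm \<sigma> i \<in> X"
    using assms(2) by (auto simp: top_perm_def)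
qed

lemma top_perm_permutes:
  assumes "\<sigma> \<in> carrier (tree_aut (Suc n))"
  shows "top_perm \<sigma> permutes X"
proof (rule bij_imp_permutes)
  have "inj_on (top_perm \<sigma>) X"
  proof (rule inj_onI)
    fix i j assume "i \<in> X" "j \<in> X" "top_perm \<sigma> i = top_perm \<sigma> j"
    then have "\<sigma> [i] = \<sigma> [j]"
      using top_perm_apply[OF assms] by simp
    then show "i = j"
      using permutes_inj[OF tree_autD(1)[OF assms]] by (auto dest: injD)
  qed
  moreover have "top_perm \<sigma> ` X \<subseteq> X"
    using top_perm_apply(2)[OF assms] by auto
  ultimately show "bij_betw (top_perm \<sigma>) X X"
    using endo_inj_surj[OF finite_X] by (simp add: bij_betw_def)
qed (simp add: top_perm_def)

lemma top_perm_comp: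
  assumes "\<sigma> \<in> carrier (tree_aut (Suc n))"
  shows "top_perm (\<tau> \<circ> \<sigma>) = top_perm \<tau> \<circ> top_perm \<sigma>"
proof
  fix i show "top_perm (\<tau> \<circ> \<sigma>) i = (top_perm \<tau> \<circ> top_perm \<sigma>) i"
    using top_perm_apply[OF assms, of i] by (cases "i \<in> X") (simp_all add: top_perm_def)
qed

lemma top_sign_comp:
  assumes "\<sigma> \<in> carrier (tree_aut (Suc n))" "\<tau> \<in> carrier (tree_aut (Suc n))"
  shows "top_sign (\<tau> \<circ> \<sigma>) = top_sign \<tau> * top_sign \<sigma>"
  unfolding top_sign_def top_perm_comp[OF assms(1)]
  using assms by (intro sign_compose permutes_imp_permutation[OF finite_X] top_perm_permutes)

lemma top_sign_id [simp]: "top_sign id = 1"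
proof -
  have "top_perm id = id" by (auto simp: top_perm_def)
  then show ?thesis by (simp add: top_sign_def)
qed

lemma top_sign_cases: "top_sign \<sigma> = 1 \<or> top_sign \<sigma> = - 1"
  by (simp add: top_sign_def sign_def)

lemma top_sign_inv:
  assumes "\<sigma> \<in> carrier (tree_aut (Suc n))"
  shows "top_sign (inv\<^bsub>tree_aut (Suc n)\<^esub> \<sigma>) = top_sign \<sigma>"
proof -
  interpret group "tree_aut (Suc n)" by (rule group_tree_aut)
  have "top_sign (\<sigma> \<circ> inv\<^bsub>tree_aut (Suc n)\<^esub> \<sigma>) = 1"
    using l_inv[OF assms] by simp
  then show ?thesis
    using top_sign_comp[OF inv_closed[OF assms] assms] top_sign_cases[of \<sigma>] by auto
qed

lemma top_sign_branch:
  assumes "\<pi> permutes X"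
  shows "top_sign (branch (Suc n) f \<pi>) = sign \<pi>"
proof -
  have "top_perm (branch (Suc n) f \<pi>) = \<pi>"
    using permutes_not_in[OF assms] by (auto simp: top_perm_def)
  then show ?thesis by (simp add: top_sign_def)
qed

text \<open>The tree of height one consists of the root and its three children, so nothing is left
  below the first level. This serves the base cases of both the generation and the counting
  argument.\<close>

lemma tree_aut_1_eq_branch:
  assumes "\<sigma> \<in> carrier (tree_aut (Suc 0))"
  shows "\<sigma> = branch (Suc 0) (\<lambda>_. id) (top_perm \<sigma>)"
proof
  fix w show "\<sigma> w = branch (Suc 0) (\<lambda>_. id) (top_perm \<sigma>) w"
  proof (cases "w \<in> tree_verts (Suc 0)")
    case True
    then show ?thesis
      using tree_autD(2)[OF assms] top_perm_apply(1)[OF assms]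
      by (elim tree_verts_Suc_cases) (auto simp: tree_verts_def)
  qed (use permutes_not_in[OF tree_autD(1)[OF assms]] in simp)
qed

section \<open>Permutations of three letters\<close>

definition rot :: "nat \<Rightarrow> nat" where
  "rot = cycle_of_list [0, 1, 2]"

definition flip :: "nat \<Rightarrow> nat" where
  "flip = cycle_of_list [0, 1]"

lemma rot_simps [simp]: "rot 0 = 1" "rot (Suc 0) = 2" "rot 2 = 0"
  by (simp_all add: rot_def transpose_def)

lemma rot_permutes: "rot permutes X"
  using cycle_permutes[of "[0, 1, 2::nat]"] by (simp add: rot_def X_def)

lemma flip_permutes: "flip permutes X"
  by (auto simp: flip_def X_def intro!: permutes_swap_id)

lemma sign_rot: "sign rot = 1" and sign_flip: "sign flip = - 1"
  by (simp_all add: rot_def flip_def sign_compose sign_swap_id permutation_swap_id permutation_compose)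

text \<open>Fixing 0 and then 1 writes \<pi> as \<open>transpose 0 b \<circ> transpose 1 b'\<close>.
  It is even iff both factors are trivial or neither is, which leaves three of the six
  pairs.\<close>

lemma even_permutes_X:
  "{\<pi>. \<pi> permutes X \<and> sign \<pi> = 1} = {id, rot, rot \<circ> rot}"
proof -
  have "\<pi> \<in> {id, rot, rot \<circ> rot}" if "\<pi> permutes X" "sign \<pi> = 1" for \<pi>
  proof -
    define b where "b = \<pi> 0"
    define q where "q = transpose 0 b \<circ> \<pi>"
    define b' where "b' = q 1"
    have "\<pi> permutes insert 0 {1, 2}"
      using that(1) by (simp add: X_def)
    then have q: "q permutes insert 1 {2}"
      unfolding q_def b_def by (rule permutes_insert_lemma)
    then have "transpose 1 b' \<circ> q permutes {2}"
      unfolding b'_def by (rule permutes_insert_lemma)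
    then have "transpose 1 b' \<circ> q = id"
      by simp
    then have "q = transpose 1 b'"
      by (metis comp_id id_comp comp_assoc transpose_comp_involutory)
    moreover have "\<pi> = transpose 0 b \<circ> q"
      by (simp add: q_def o_assoc)
    moreover have "b \<in> {0, 1, 2}" "b' \<in> {1, 2}"
      using permutes_in_image[OF that(1), of 0] permutes_in_image[OF q, of 1]
      by (auto simp: b_def b'_def X_def)
    ultimately have b: "b \<in> {0, 1, 2}" "b' \<in> {1, 2}" "\<pi> = transpose 0 b \<circ> transpose 1 b'"
      by auto
    then have "sign \<pi> = sign (transpose 0 b) * sign (transpose 1 b')"
      by (simp add: sign_compose permutation_swap_id)
    then have "b = 0 \<and> b' = 1 \<or> b = 1 \<and> b' = 2 \<or> b = 2 \<and> b' = 2"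
      using that(2) b by (auto simp: sign_swap_id)
    moreover have "transpose 0 1 \<circ> transpose 1 2 = rot"
      by (auto simp: rot_def)
    moreover have "transpose 0 2 \<circ> transpose 1 2 = rot \<circ> rot"
      by (rule ext) (auto simp: rot_def transpose_def)
    ultimately show ?thesis
      using b(3) by auto
  qed
  moreover have "rot \<circ> rot permutes X" "sign (rot \<circ> rot) = 1"
    using rot_permutes permutes_imp_permutation[OF finite_X rot_permutes]
    by (auto simp: permutes_compose sign_compose sign_rot)
  ultimately show ?thesis
    using rot_permutes sign_rot by auto
qed

text \<open>Composition with the odd involution \<open>flip\<close> exchanges the even and the odd
  permutations.\<close>

lemma card_permutes_X_sign:
  assumes "s = 1 \<or> s = (- 1 :: int)"
  shows "card {\<pi>. \<pi> permutes X \<and> sign \<pi> = s} = 3"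
proof -
  have "id \<noteq> rot" "id \<noteq> rot \<circ> rot" "rot \<noteq> rot \<circ> rot"
    by (auto dest!: fun_cong[where x = 0])
  then have 3: "card {\<pi>. \<pi> permutes X \<and> sign \<pi> = 1} = 3"
    unfolding even_permutes_X by simp
  have ff: "flip \<circ> flip = id"
    by (simp add: flip_def)
  have sf: "sign (flip \<circ> \<pi>) = - sign \<pi>" if "\<pi> permutes X" for \<pi>
    using that permutes_imp_permutation[OF finite_X] flip_permutes
    by (simp add: sign_compose sign_flip)
  have "bij_betw ((\<circ>) flip) {\<pi>. \<pi> permutes X \<and> sign \<pi> = 1} {\<pi>. \<pi> permutes X \<and> sign \<pi> = - 1}"
    by (rule bij_betw_byWitness[where f' = "(\<circ>) flip"])
      (auto simp: o_assoc ff sf intro!: permutes_compose[OF _ flip_permutes])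
  then show ?thesis
    using 3 assms by (auto simp: bij_betw_same_card[symmetric])
qed

section \<open>The groups cut out by the sign condition\<close>

text \<open>The index is shifted by one: \<open>parity_group k\<close> will be \<open>M\<^sub>k\<^sub>+\<^sub>1\<close>, and \<open>even_part k\<close> will be \<open>L\<^sub>k\<^sub>+\<^sub>1\<close>.\<close>

fun parity_group :: "nat \<Rightarrow> (nat list \<Rightarrow> nat list) set" where
  "parity_group 0 = carrier (tree_aut 1)"
| "parity_group (Suc k) = {branch (Suc (Suc k)) f \<pi> | f \<pi>.
     \<pi> permutes X \<and> (\<forall>i\<in>X. f i \<in> parity_group k) \<and> (\<Prod>i\<in>X. top_sign (f i)) = sign \<pi>}"

declare parity_group.simps(2) [simp del]

definition even_part :: "nat \<Rightarrow> (nat list \<Rightarrow> nat list) set" where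
  "even_part k = {\<sigma> \<in> parity_group k. top_sign \<sigma> = 1}"

lemma parity_group_subset: "parity_group k \<subseteq> carrier (tree_aut (Suc k))"
  by (induction k) (auto simp: parity_group.simps(2) intro!: branch_in_tree_aut)

text \<open>Signs are multiplicative, and so is the condition linking the signs of the coordinates
  to that of the top permutation.\<close>

lemma parity_group_comp:
  assumes "\<sigma> \<in> parity_group k" "\<tau> \<in> parity_group k"
  shows "\<tau> \<circ> \<sigma> \<in> parity_group k"
  using assms
proof (induction k arbitrary: \<sigma> \<tau>)
  case 0
  then show ?case
    using group.is_monoid[OF group_tree_aut, THEN monoid.m_closed, of \<sigma> 1 \<tau>]
    unfolding parity_group.simps(1) mult_tree_aut by blast
next
  case (Suc k)
  obtain f \<pi> where f: "\<sigma> = branch (Suc (Suc k)) f \<pi>" "\<pi> permutes X" "\<And>i. i \<in> X \<Longrightarrow> f i \<in> parity_group k"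
    "(\<Prod>i\<in>X. top_sign (f i)) = sign \<pi>"
    using Suc.prems(1) by (auto simp: parity_group.simps(2))
  obtain g \<rho> where g: "\<tau> = branch (Suc (Suc k)) g \<rho>" "\<rho> permutes X" "\<And>i. i \<in> X \<Longrightarrow> g i \<in> parity_group k"
    "(\<Prod>i\<in>X. top_sign (g i)) = sign \<rho>"
    using Suc.prems(2) by (auto simp: parity_group.simps(2))
  have \<pi>: "\<pi> i \<in> X" if "i \<in> X" for i
    using permutes_in_image[OF f(2)] that by simp
  have "\<tau> \<circ> \<sigma> = branch (Suc (Suc k)) (\<lambda>i. g (\<pi> i) \<circ> f i) (\<rho> \<circ> \<pi>)"
    unfolding f(1) g(1) using f(2,3) parity_group_subset by (intro branch_comp) auto
  moreover have "(\<Prod>i\<in>X. top_sign (g (\<pi> i) \<circ> f i)) = (\<Prod>i\<in>X. top_sign (g (\<pi> i)) * top_sign (f i))"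
    using parity_group_subset f(3) g(3) \<pi> by (intro prod.cong refl top_sign_comp) blast+
  \<comment> \<open>\<pi> only reorders the factors that come from \<open>g\<close>.\<close>
  moreover have "\<dots> = (\<Prod>i\<in>X. top_sign (g i)) * (\<Prod>i\<in>X. top_sign (f i))"
    using prod.permute[OF f(2), of "\<lambda>i. top_sign (g i)"] by (simp add: prod.distrib o_def)
  moreover have "\<dots> = sign (\<rho> \<circ> \<pi>)"
    using f(2,4) g(2,4) permutes_imp_permutation[OF finite_X] by (simp add: sign_compose)
  moreover have "g (\<pi> i) \<circ> f i \<in> parity_group k" if "i \<in> X" for i
    using Suc.IH f(3) g(3) \<pi> that by blast
  ultimately show ?case
    unfolding parity_group.simps(2) using permutes_compose[OF f(2) g(2)] by auto
qed

lemma id_in_parity_group [simp]: "id \<in> parity_group k"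
proof (induction k)
  case (Suc k)
  then have "branch (Suc (Suc k)) (\<lambda>_. id) id \<in> parity_group (Suc k)"
    unfolding parity_group.simps(2) mem_Collect_eq
    by (intro exI[of _ "\<lambda>_. id"] exI[of _ id]) (simp add: top_sign_id del: id_apply)
  moreover have "branch (Suc (Suc k)) (\<lambda>_. id) id = id"
    by (rule branch_id) (rule refl)
  ultimately show ?case
    by metis
qed (unfold parity_group.simps(1), rule id_in_tree_aut)

lemma subgroup_parity_group: "subgroup (parity_group k) (tree_aut (Suc k))"
proof (rule group.finite_submonoid_subgroup[OF group_tree_aut finite_subset[OF parity_group_subset finite_tree_aut] parity_group_subset])
  show "parity_group k \<noteq> {}"
    using id_in_parity_group by blast
qed (simp add: parity_group_comp)

lemma subgroup_even_part: "subgroup (even_part k) (tree_aut (Suc k))"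
proof (rule group.finite_submonoid_subgroup[OF group_tree_aut])
  show "even_part k \<subseteq> carrier (tree_aut (Suc k))"
    using parity_group_subset by (auto simp: even_part_def)
  then show "finite (even_part k)"
    using finite_tree_aut finite_subset by blast
  have "id \<in> even_part k"
    by (simp add: even_part_def)
  then show "even_part k \<noteq> {}"
    by blast
  show "\<sigma> \<otimes>\<^bsub>tree_aut (Suc k)\<^esub> \<tau> \<in> even_part k" if "\<sigma> \<in> even_part k" "\<tau> \<in> even_part k" for \<sigma> \<tau>
    using that parity_group_subset by (auto simp: even_part_def parity_group_comp top_sign_comp[where n = k] subset_iff)
qed

lemma node_in_parity_group:
  assumes "a \<in> parity_group k" "b \<in> parity_group k" "c \<in> parity_group k" "\<pi> permutes X" "top_sign a * top_sign b * top_sign c = sign \<pi>"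
  shows "node (Suc (Suc k)) a b c \<pi> \<in> parity_group (Suc k)"
proof -
  have "(\<Prod>i\<in>X. top_sign ([a, b, c] ! i)) = sign \<pi>"
    using assms(5) by (simp add: X_def mult.assoc)
  moreover have "\<forall>i\<in>X. [a, b, c] ! i \<in> parity_group k"
    using assms(1-3) by (simp add: X_def)
  ultimately show ?thesis
    unfolding parity_group.simps(2) node_eq_branch using assms(4) by blast
qed

lemma top_sign_node: "\<pi> permutes X \<Longrightarrow> top_sign (node (Suc n) a b c \<pi>) = sign \<pi>"
  by (simp add: node_eq_branch top_sign_branch)

lemma node_1_in_parity_group: 
  assumes "\<pi> permutes X"
  shows "node (Suc 0) id id id \<pi> \<in> parity_group 0"
proof -
  have "[id, id, id] ! i \<in> carrier (tree_aut 0)" if "i \<in> X" for i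
    using that by (auto simp: X_def)
  then show ?thesis
    using branch_in_tree_aut assms by (simp add: node_eq_branch)
qed

section \<open>The generators satisfy the sign condition\<close>

lemma gen_simps:
  "x_gen (Suc 0) = node (Suc 0) id id id rot"
  "x_gen (Suc (Suc k)) = node (Suc (Suc k)) id id (x_gen (Suc k)) rot"
  "y_gen (Suc 0) = node (Suc 0) id id id flip"
  "y_gen (Suc (Suc k)) = node (Suc (Suc k)) id (y_gen (Suc k)) (x_gen (Suc k)) flip"
  by (simp_all add: rot_def flip_def)

declare x_gen.simps [simp del] y_gen.simps [simp del] z_gen.simps [simp del]

text \<open>All three coordinates are even, and so is the 3-cycle on top.\<close>

lemma x_gen_in_even_part: "x_gen (Suc k) \<in> even_part k"
proof (induction k)
  case 0
  then show ?case
    using node_1_in_parity_group[OF rot_permutes] by (simp add: even_part_def gen_simps top_sign_node rot_permutes sign_rot)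
next
  case (Suc k)
  then show ?case
    by (simp add: even_part_def gen_simps node_in_parity_group top_sign_node rot_permutes sign_rot)
qed

text \<open>Exactly one coordinate, the previous \<open>y_gen\<close>, is odd; this matches the odd
  transposition on top.\<close>

lemma y_gen_in_parity_group: "y_gen (Suc k) \<in> parity_group k \<and> top_sign (y_gen (Suc k)) = - 1"
proof (induction k)
  case 0
  then show ?case
    using node_1_in_parity_group[OF flip_permutes] by (simp add: gen_simps top_sign_node flip_permutes sign_flip)
next
  case (Suc k)
  then show ?case
    using x_gen_in_even_part[of k]
    by (simp add: even_part_def gen_simps node_in_parity_group top_sign_node flip_permutes sign_flip)
qed

text \<open>The two odd coordinates cancel, in accordance with the trivial top permutation.\<close>

lemma z_gen_in_even_part: "z_gen (Suc (Suc k)) \<in> even_part (Suc k)"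
  using x_gen_in_even_part[of k] y_gen_in_parity_group[of k] by (simp add: even_part_def z_gen.simps node_in_parity_group top_sign_node)

lemma embed_in_even_part: "\<sigma> \<in> even_part k \<Longrightarrow> embed (Suc (Suc k)) \<sigma> \<in> even_part (Suc k)"
  by (simp add: even_part_def embed_def node_in_parity_group top_sign_node)

section \<open>Generation of the even part\<close>

text \<open>Stated for an arbitrary subgroup \<open>S\<close> so that it applies to \<open>L\<close>
  in the induction step and again to \<open>M\<close>. Inside \<open>S\<close> one finds all triples
  of even elements, every admissible sign pattern, and every even top permutation; products of these
  exhaust the even part.\<close>

lemma even_part_subset:
  fixes k :: nat
  defines "A \<equiv> tree_aut (Suc (Suc k))" and "B \<equiv> branch (Suc (Suc k))"
  assumes S: "subgroup S A" and x: "x_gen (Suc (Suc k)) \<in> S" and z: "z_gen (Suc (Suc k)) \<in> S"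
    and emb: "\<And>\<sigma>. \<sigma> \<in> even_part k \<Longrightarrow> embed (Suc (Suc k)) \<sigma> \<in> S"
  shows "even_part (Suc k) \<subseteq> S"
proof -
  interpret A: group A unfolding A_def by (rule group_tree_aut)
  let ?T = "tree_aut (Suc k)"
  interpret T: group ?T by (rule group_tree_aut)
  interpret Gk: subgroup "parity_group k" ?T by (rule subgroup_parity_group)
  interpret Hk: subgroup "even_part k" ?T by (rule subgroup_even_part)
  interpret S: subgroup S A by (rule S)
  define x' where "x' = x_gen (Suc k)"
  define y' where "y' = y_gen (Suc k)"
  have x': "x' \<in> even_part k" "x' \<in> parity_group k" "top_sign x' = 1" "x' \<in> carrier ?T"
    using x_gen_in_even_part[of k] parity_group_subset[of k] by (auto simp: even_part_def x'_def)
  have y': "y' \<in> parity_group k" "top_sign y' = - 1" "y' \<in> carrier ?T"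
    using y_gen_in_parity_group[of k] parity_group_subset[of k] by (auto simp: y'_def)
  have S_comp: "\<tau> \<circ> \<sigma> \<in> S" if "\<sigma> \<in> S" "\<tau> \<in> S" for \<sigma> \<tau>
    using S.m_closed[OF that] by (simp add: A_def)
  have B_comp: "B g \<rho> \<circ> B f \<pi> = B (\<lambda>i. g (\<pi> i) \<circ> f i) (\<rho> \<circ> \<pi>)"
    if "\<And>i. i \<in> X \<Longrightarrow> f i \<in> carrier ?T" "\<pi> permutes X" for f g \<pi> \<rho>
    unfolding B_def using that by (rule branch_comp)
  have B_cong: "B f \<pi> = B g \<pi>" if "\<And>i. i \<in> X \<Longrightarrow> f i = g i" for f g \<pi>
    unfolding B_def using that by (rule branch_cong)
  have B_in: "B f \<pi> \<in> carrier A" if "\<And>i. i \<in> X \<Longrightarrow> f i \<in> carrier ?T" "\<pi> permutes X" for f \<pi>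
    unfolding A_def B_def using that by (rule branch_in_tree_aut)
  have x_eq: "x_gen (Suc (Suc k)) = B ((!) [id, id, x']) rot"
    by (simp add: B_def node_eq_branch x'_def gen_simps)
  have z_eq: "z_gen (Suc (Suc k)) = B ((!) [y', y', x']) id"
    by (simp add: B_def node_eq_branch x'_def y'_def z_gen.simps)
  \<comment> \<open>In the right-action order this is \<open>x'\<close> times \<open>a\<close> times
    the inverse of \<open>x'\<close>. It arises because the coordinate of \<open>x_gen\<close> at 2
    is \<open>x'\<close>.\<close>
  define conj where "conj a = inv\<^bsub>?T\<^esub> x' \<circ> a \<circ> x'" for a
  have conj_G: "conj a \<in> parity_group k" if "a \<in> parity_group k" for a
    using that x'(2) parity_group_comp Gk.m_inv_closed by (auto simp: conj_def)
  have carr: "a \<in> carrier ?T" if "a \<in> parity_group k" for a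
    using that parity_group_subset by blast
  have sg_T: "top_sign (b \<circ> a) = top_sign b * top_sign a" if "a \<in> parity_group k" "b \<in> parity_group k" for a b
    using top_sign_comp[of a k b] that carr by blast
  have sg_conj: "top_sign (conj a) = top_sign a" if "a \<in> parity_group k" for a
    using that x' by (simp add: conj_def sg_T parity_group_comp top_sign_inv)
  \<comment> \<open>Conjugation by \<open>x\<close> rotates the three coordinates.\<close>
  have rotate: "B ((!) [b, c, conj a]) id \<in> S"
    if S': "B ((!) [a, b, c]) id \<in> S" and abc: "a \<in> parity_group k" "b \<in> parity_group k" "c \<in> parity_group k" for a b c
  proof -
    let ?x = "x_gen (Suc (Suc k))" and ?v = "B ((!) [a, b, c]) id"
      and ?w = "B ((!) [b, c, conj a]) id"
    note carr_abc = carr[OF abc(1)] carr[OF abc(2)] carr[OF abc(3)] carr[OF conj_G[OF abc(1)]]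
    have w: "?w \<in> carrier A"
      using carr_abc by (intro B_in permutes_id nth3_in)
    have "?v \<circ> ?x = B (\<lambda>i. [a, b, c] ! rot i \<circ> [id, id, x'] ! i) rot"
      unfolding x_eq using x'(4) rot_permutes by (simp add: B_comp nth3_in)
    also have "\<dots> = B (\<lambda>i. [id, id, x'] ! i \<circ> [b, c, conj a] ! i) rot"
    proof (rule B_cong)
      \<comment> \<open>The group product is reversed composition, so the left inverse law yields
        this order of the factors.\<close>
      have "x' \<circ> inv\<^bsub>?T\<^esub> x' = id"
        using T.l_inv[OF x'(4)] by simp
      \<comment> \<open>This settles coordinate 2, which \<open>rot\<close> sends to 0; the other
        two coordinates only get relabelled.\<close>
      then have "x' \<circ> conj a = a \<circ> x'"
        unfolding conj_def by (simp add: o_assoc)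
      then show "[a, b, c] ! rot i \<circ> [id, id, x'] ! i = [id, id, x'] ! i \<circ> [b, c, conj a] ! i"
        if "i \<in> X" for i
        using that by (auto simp: X_def)
    qed
    also have "\<dots> = ?x \<circ> ?w"
      unfolding x_eq using carr_abc by (simp add: B_comp nth3_in)
    finally have "?x \<otimes>\<^bsub>A\<^esub> ?v = ?w \<otimes>\<^bsub>A\<^esub> ?x"
      by (simp add: A_def)
    then have "?w = ?x \<otimes>\<^bsub>A\<^esub> ?v \<otimes>\<^bsub>A\<^esub> inv\<^bsub>A\<^esub> ?x"
      using A.inv_solve_right[of ?w "?x \<otimes>\<^bsub>A\<^esub> ?v" ?x] w S' x by auto
    then show ?thesis
      using S' x by auto
  qed
  have pos0: "B ((!) [a, id, id]) id \<in> S" if "a \<in> even_part k" for a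
    using emb[OF that] by (simp add: embed_def node_eq_branch B_def)
  have pos2: "B ((!) [id, id, a]) id \<in> S" if "a \<in> even_part k" for a
  proof -
    \<comment> \<open>The preimage of \<open>a\<close> under \<open>conj\<close>: rotating the
      triple with \<open>b\<close> in front leaves exactly \<open>a\<close> in the last
      place.\<close>
    define b where "b = x' \<circ> a \<circ> inv\<^bsub>?T\<^esub> x'"
    have b: "b \<in> even_part k"
      using Hk.m_closed[OF Hk.m_closed[OF Hk.m_inv_closed[OF x'(1)] that] x'(1)]
      by (simp add: b_def o_assoc)
    have "inv\<^bsub>?T\<^esub> x' \<circ> x' = id"
      using T.r_inv[OF x'(4)] by simp
    then have "conj b = a"
      unfolding conj_def b_def by (metis comp_assoc comp_id id_comp)
    moreover have "B ((!) [id, id, conj b]) id \<in> S"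
      using rotate[OF pos0[OF b]] b by (simp add: even_part_def)
    ultimately show ?thesis by simp
  qed
  have pos1: "B ((!) [id, a, id]) id \<in> S" if "a \<in> even_part k" for a
  proof -
    have "conj id = id"
      using T.r_inv[OF x'(4)] by (simp add: conj_def)
    then show ?thesis
      using rotate[OF pos2[OF that]] that by (simp add: even_part_def)
  qed
  \<comment> \<open>A triple of even elements is a product of three triples with a single nontrivial
    coordinate each.\<close>
  have diag: "B h id \<in> S" if h: "\<And>i. i \<in> X \<Longrightarrow> h i \<in> even_part k" for h
  proof -
    have h': "h 0 \<in> even_part k" "h 1 \<in> even_part k" "h 2 \<in> even_part k"
      using h by (auto simp: X_def)
    then have c: "h 0 \<in> carrier ?T" "h 1 \<in> carrier ?T" "h 2 \<in> carrier ?T"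
      using Hk.mem_carrier by blast+
    have "B ((!) [h 0, id, id]) id \<circ> B ((!) [id, h 1, id]) id \<circ> B ((!) [id, id, h 2]) id = B h id"
      using c by (simp add: B_comp nth3_in) (rule B_cong, auto simp: X_def)
    then show ?thesis
      using S_comp pos0 pos1 pos2 h' by metis
  qed
  \<comment> \<open>For a fixed top permutation, membership in \<open>S\<close> depends only on the
    signs of the coordinates: \<open>f i\<close> and \<open>g i\<close> differ by an even factor,
    and \<open>diag\<close> supplies these factors.\<close>
  have absorb: "B f \<pi> \<in> S"
    if gS: "B g \<pi> \<in> S" and fg: "\<And>i. i \<in> X \<Longrightarrow> f i \<in> parity_group k \<and> g i \<in> parity_group k \<and> top_sign (f i) = top_sign (g i)"
    for f g \<pi>
  proof -
    define h where "h i = inv\<^bsub>?T\<^esub> (g i) \<circ> f i" for i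
    have h: "h i \<in> even_part k" "g i \<circ> h i = f i" if "i \<in> X" for i
    proof -
      have g: "f i \<in> parity_group k" "g i \<in> parity_group k" "top_sign (f i) = top_sign (g i)" "inv\<^bsub>?T\<^esub> (g i) \<in> parity_group k"
        using fg[OF that] by auto
      then show "h i \<in> even_part k"
        using top_sign_cases[of "g i"] by (auto simp: h_def even_part_def parity_group_comp sg_T top_sign_inv carr)
      have "g i \<circ> inv\<^bsub>?T\<^esub> (g i) = id"
        using T.l_inv[OF carr[OF g(2)]] by simp
      then show "g i \<circ> h i = f i"
        by (simp add: h_def o_assoc)
    qed
    have "B g \<pi> \<circ> B h id = B f \<pi>"
      using h Hk.mem_carrier by (simp add: B_comp) (rule B_cong, simp)
    then show ?thesis
      using S_comp[OF diag gS] h(1) by metis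
  qed
  \<comment> \<open>The witnesses are the identity, \<open>x_gen\<close> and its square.\<close>
  have even_perm: "\<exists>h. B h \<pi> \<in> S \<and> (\<forall>i\<in>X. h i \<in> even_part k)" if "\<pi> \<in> {id, rot, rot \<circ> rot}" for \<pi>
  proof -
    let ?h = "(!) [id, id, x']"
    have h: "?h i \<in> even_part k" if "i \<in> X" for i
      using that x'(1) by (intro nth3_in) (simp_all add: even_part_def)
    have h2: "?h (rot i) \<circ> ?h i \<in> even_part k" if "i \<in> X" for i
      using Hk.m_closed[OF h h] that permutes_in_image[OF rot_permutes] by simp
    have "B (\<lambda>_. id) id \<in> S"
      by (rule diag) (simp add: even_part_def)
    moreover have "B (\<lambda>i. ?h (rot i) \<circ> ?h i) (rot \<circ> rot) \<in> S"
      using S_comp[OF x x] h Hk.mem_carrier rot_permutes unfolding x_eq by (subst (asm) B_comp) auto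
    moreover have "id \<in> even_part k"
      by (simp add: even_part_def)
    ultimately show ?thesis
      using that h h2 x unfolding x_eq by blast
  qed
  \<comment> \<open>Signs of product 1 contain no minus or exactly two. The three patterns with two
    minus signs come from \<open>z_gen\<close> and its two successive rotations.\<close>
  have signs: "\<exists>g. B g id \<in> S \<and> (\<forall>i\<in>X. g i \<in> parity_group k \<and> top_sign (g i) = top_sign (f i))"
    if "(\<Prod>i\<in>X. top_sign (f i)) = 1" for f
  proof -
    have z0: "B ((!) [y', y', x']) id \<in> S"
      using z z_eq by simp
    then have z1: "B ((!) [y', x', conj y']) id \<in> S"
      using rotate x' y' by blast
    then have z2: "B ((!) [x', conj y', conj y']) id \<in> S"
      using rotate x' y' conj_G by blast
    have one: "B (\<lambda>_. id) id \<in> S"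
      by (rule diag) (simp add: even_part_def)
    have "top_sign (f 0) * (top_sign (f 1) * top_sign (f 2)) = 1"
      using that by (simp add: X_def)
    then consider "top_sign (f 0) = 1" "top_sign (f 1) = 1" "top_sign (f 2) = 1"
      | "top_sign (f 0) = - 1" "top_sign (f 1) = - 1" "top_sign (f 2) = 1"
      | "top_sign (f 0) = - 1" "top_sign (f 1) = 1" "top_sign (f 2) = - 1"
      | "top_sign (f 0) = 1" "top_sign (f 1) = - 1" "top_sign (f 2) = - 1"
      using top_sign_cases[of "f 0"] top_sign_cases[of "f 1"] top_sign_cases[of "f 2"] by fastforce
    then show ?thesis
    proof cases
      case 1
      with one show ?thesis
        by (intro exI[of _ "\<lambda>_. id"]) (simp add: X_def)
    next
      case 2
      with z0 show ?thesis
        using x' y' by (intro exI[of _ "(!) [y', y', x']"]) (simp add: X_def)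
    next
      case 3
      with z1 show ?thesis
        using x' y' conj_G sg_conj by (intro exI[of _ "(!) [y', x', conj y']"]) (simp add: X_def)
    next
      case 4
      with z2 show ?thesis
        using x' y' conj_G sg_conj
        by (intro exI[of _ "(!) [x', conj y', conj y']"]) (simp add: X_def)
    qed
  qed
  show ?thesis
  proof
    fix \<sigma> assume "\<sigma> \<in> even_part (Suc k)"
    then obtain f \<pi> where f: "\<sigma> = B f \<pi>" "\<pi> permutes X" "\<And>i. i \<in> X \<Longrightarrow> f i \<in> parity_group k"
      "(\<Prod>i\<in>X. top_sign (f i)) = sign \<pi>" "top_sign \<sigma> = 1"
      unfolding even_part_def parity_group.simps(2) B_def by blast
    then have \<pi>: "sign \<pi> = 1"
      using top_sign_branch[OF f(2)] by (simp add: B_def)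
    then obtain h where h: "B h \<pi> \<in> S" "\<And>i. i \<in> X \<Longrightarrow> h i \<in> even_part k"
      using even_perm[of \<pi>] f(2) even_permutes_X by blast
    obtain g where g: "B g id \<in> S" "\<And>i. i \<in> X \<Longrightarrow> g i \<in> parity_group k \<and> top_sign (g i) = top_sign (f i)"
      using signs[of f] f(4) \<pi> by auto
    \<comment> \<open>Each \<open>h i\<close> is even, so this element has the top permutation and
      the coordinate signs of \<sigma>; \<open>absorb\<close> then adjusts the coordinates
      themselves.\<close>
    have "B h \<pi> \<circ> B g id = B (\<lambda>i. h i \<circ> g i) \<pi>"
      using g(2) carr by (simp add: B_comp)
    then have "B (\<lambda>i. h i \<circ> g i) \<pi> \<in> S"
      using S_comp[OF g(1) h(1)] by simp
    then show "\<sigma> \<in> S"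
      unfolding f(1)
    proof (rule absorb)
      fix i assume "i \<in> X"
      then show "f i \<in> parity_group k \<and> h i \<circ> g i \<in> parity_group k \<and> top_sign (f i) = top_sign (h i \<circ> g i)"
        using h(2) g(2) f(3) by (auto simp: even_part_def parity_group_comp sg_T)
    qed
  qed
qed

section \<open>Identification of \<open>L\<close> and \<open>M\<close>\<close>

text \<open>On the first level the even permutations are the powers of the 3-cycle.\<close>

lemma L_1_eq_even_part: "L (Suc 0) = even_part 0"
proof
  interpret group "tree_aut (Suc 0)" by (rule group_tree_aut)
  show "L (Suc 0) \<subseteq> even_part 0"
    using generate_subgroup_incl[OF _ subgroup_even_part[of 0], of "{x_gen 1}"] x_gen_in_even_part[of 0]
    by simp
  show "even_part 0 \<subseteq> L (Suc 0)"
  proof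
    fix \<sigma> assume "\<sigma> \<in> even_part 0"
    then have \<sigma>: "\<sigma> \<in> carrier (tree_aut (Suc 0))" "top_sign \<sigma> = 1"
      by (auto simp: even_part_def)
    have x: "x_gen (Suc 0) = branch (Suc 0) (\<lambda>_. id) rot"
      by (auto simp: gen_simps node_eq_branch X_def intro!: branch_cong)
    have xx: "x_gen (Suc 0) \<circ> x_gen (Suc 0) = branch (Suc 0) (\<lambda>_. id) (rot \<circ> rot)"
      unfolding x by (simp add: branch_comp rot_permutes)
    have gen: "x_gen (Suc 0) \<in> L (Suc 0)"
      by (simp add: generate.incl)
    have "x_gen (Suc 0) \<circ> x_gen (Suc 0) \<in> L (Suc 0)"
      using generate.eng[of "x_gen (Suc 0)" "tree_aut (Suc 0)" "{x_gen (Suc 0)}" "x_gen (Suc 0)"] gen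
      by simp
    moreover have "branch (Suc 0) (\<lambda>_. id) id \<in> L (Suc 0)"
      using generate.one[of "tree_aut (Suc 0)"] by (simp add: branch_id)
    moreover have "top_perm \<sigma> \<in> {id, rot, rot \<circ> rot}"
      using \<sigma> top_perm_permutes even_permutes_X by (auto simp: top_sign_def)
    ultimately show "\<sigma> \<in> L (Suc 0)"
      using tree_aut_1_eq_branch[OF \<sigma>(1)] gen x xx by (metis insertE empty_iff)
  qed
qed

text \<open>The induction hypothesis turns the embedded copy of the previous \<open>L\<close> into
  that of the previous even part, which is what \<open>even_part_subset\<close> asks for.\<close>

lemma L_eq_even_part: "L (Suc k) = even_part k"
proof (induction k)
  case (Suc k)
  let ?n = "Suc (Suc k)"
  let ?gens = "{x_gen ?n, z_gen ?n} \<union> embed ?n ` even_part k"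
  interpret group "tree_aut ?n" by (rule group_tree_aut)
  have L: "L ?n = generate (tree_aut ?n) ?gens"
    by (simp add: Suc.IH)
  have gens: "?gens \<subseteq> even_part (Suc k)"
    using x_gen_in_even_part z_gen_in_even_part embed_in_even_part by blast
  show ?case
  proof
    show "L ?n \<subseteq> even_part (Suc k)"
      unfolding L by (rule generate_subgroup_incl[OF gens subgroup_even_part])
    have "subgroup (L ?n) (tree_aut ?n)"
      unfolding L using gens subgroup.subset[OF subgroup_even_part] by (intro generate_is_subgroup) blast
    then show "even_part (Suc k) \<subseteq> L ?n"
      by (rule even_part_subset) (auto simp: L simp del: L.simps intro!: generate.incl)
  qed
qed (rule L_1_eq_even_part)

text \<open>\<open>M\<close> contains the even part by \<open>even_part_subset\<close>, and the odd
  element \<open>y_gen\<close> gives the other coset. For \<open>k = 0\<close> both sides are the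
  full automorphism group.\<close>

lemma M_eq_parity_group: "M (Suc k) = parity_group k"
proof (cases k)
  case (Suc j)
  let ?n = "Suc (Suc j)"
  let ?A = "tree_aut ?n"
  let ?gens = "{x_gen ?n, y_gen ?n, z_gen ?n} \<union> embed ?n ` even_part j"
  interpret group ?A by (rule group_tree_aut)
  have M: "M ?n = generate ?A ?gens"
    by (simp add: L_eq_even_part del: L.simps)
  have H_G: "even_part (Suc j) \<subseteq> parity_group (Suc j)"
    by (auto simp: even_part_def)
  have gens: "?gens \<subseteq> parity_group (Suc j)"
    using x_gen_in_even_part z_gen_in_even_part embed_in_even_part y_gen_in_parity_group H_G by blast
  have "M ?n \<subseteq> parity_group (Suc j)"
    unfolding M by (rule generate_subgroup_incl[OF gens subgroup_parity_group])
  moreover have "parity_group (Suc j) \<subseteq> M ?n"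
  proof
    fix \<sigma> assume \<sigma>: "\<sigma> \<in> parity_group (Suc j)"
    have sub: "subgroup (M ?n) ?A"
      unfolding M using gens subgroup.subset[OF subgroup_parity_group] by (intro generate_is_subgroup) blast
    then have H: "even_part (Suc j) \<subseteq> M ?n"
      by (rule even_part_subset)
        (auto simp: M simp del: L.simps M.simps intro!: generate.incl)
    let ?y = "y_gen ?n"
    have y: "?y \<in> parity_group (Suc j)" "top_sign ?y = - 1"
      using y_gen_in_parity_group by blast+
    have yM: "?y \<in> M ?n"
      unfolding M by (rule generate.incl) simp
    show "\<sigma> \<in> M ?n"
    proof (cases "top_sign \<sigma> = 1")
      case False
      have c: "\<sigma> \<in> carrier ?A" "?y \<in> carrier ?A"
        using \<sigma> y parity_group_subset by blast+
      \<comment> \<open>Two odd factors have an even product; multiplying by the inverse of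
        \<open>?y\<close> then recovers \<sigma>.\<close>
      have "\<sigma> \<otimes>\<^bsub>?A\<^esub> ?y \<in> even_part (Suc j)"
        using False top_sign_cases[of \<sigma>] \<sigma> y c by (simp add: even_part_def parity_group_comp top_sign_comp)
      then have "\<sigma> \<otimes>\<^bsub>?A\<^esub> ?y \<otimes>\<^bsub>?A\<^esub> inv\<^bsub>?A\<^esub> ?y \<in> M ?n"
        using H sub yM subgroup.m_closed subgroup.m_inv_closed by (metis subsetD)
      then show ?thesis
        using c by (metis m_assoc inv_closed r_inv r_one)
    qed (use \<sigma> H in \<open>auto simp: even_part_def\<close>)
  qed
  ultimately show ?thesis
    using Suc by simp
qed simp

section \<open>Counting\<close>

lemma card_parity_group_0: "card (parity_group 0) = 6"
proof -
  have "bij_betw top_perm (parity_group 0) {\<pi>. \<pi> permutes X}"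
  proof (rule bij_betw_byWitness[where f' = "branch (Suc 0) (\<lambda>_. id)"])
    show "\<forall>\<sigma>\<in>parity_group 0. branch (Suc 0) (\<lambda>_. id) (top_perm \<sigma>) = \<sigma>"
      using tree_aut_1_eq_branch by simp
    show "\<forall>\<pi>\<in>{\<pi>. \<pi> permutes X}. top_perm (branch (Suc 0) (\<lambda>_. id) \<pi>) = \<pi>"
    proof (intro ballI ext)
      fix \<pi> i assume "\<pi> \<in> {\<pi>. \<pi> permutes X}"
      then show "top_perm (branch (Suc 0) (\<lambda>_. id) \<pi>) i = \<pi> i"
        using permutes_not_in[of \<pi> X i] by (simp add: top_perm_def)
    qed
    show "top_perm ` parity_group 0 \<subseteq> {\<pi>. \<pi> permutes X}"
      using top_perm_permutes[of _ 0] by auto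
    show "branch (Suc 0) (\<lambda>_. id) ` {\<pi>. \<pi> permutes X} \<subseteq> parity_group 0"
      using branch_in_tree_aut[of "\<lambda>_. id" 0] by auto
  qed
  then show ?thesis
    using card_permutations[OF card_X finite_X] by (simp add: bij_betw_same_card fact_numeral)
qed

text \<open>Every triple of coordinates prescribes the sign of the top permutation, and three
  permutations have that sign.\<close>

lemma card_parity_group_Suc: "card (parity_group (Suc k)) = 3 * card (parity_group k) ^ 3"
proof -
  \<comment> \<open>Extensional functions make the code of an element unique.\<close>
  let ?P = "SIGMA f : X \<rightarrow>\<^sub>E parity_group k. {\<pi>. \<pi> permutes X \<and> sign \<pi> = (\<Prod>i\<in>X. top_sign (f i))}"
  let ?b = "\<lambda>(f, \<pi>). branch (Suc (Suc k)) f \<pi>"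
  have "?b ` ?P = parity_group (Suc k)"
  proof
    show "?b ` ?P \<subseteq> parity_group (Suc k)"
      unfolding parity_group.simps(2) by (fastforce simp: PiE_iff)
    show "parity_group (Suc k) \<subseteq> ?b ` ?P"
    proof
      fix \<sigma> assume "\<sigma> \<in> parity_group (Suc k)"
      then obtain f \<pi> where f: "\<sigma> = branch (Suc (Suc k)) f \<pi>" "\<pi> permutes X"
        "\<forall>i\<in>X. f i \<in> parity_group k" "(\<Prod>i\<in>X. top_sign (f i)) = sign \<pi>"
        unfolding parity_group.simps(2) by blast
      have "\<sigma> = ?b (restrict f X, \<pi>)"
        unfolding f(1) prod.case by (rule branch_cong) simp
      moreover have "(restrict f X, \<pi>) \<in> ?P"
        using f by auto
      ultimately show "\<sigma> \<in> ?b ` ?P"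
        by (rule image_eqI)
    qed
  qed
  moreover have inj: "inj_on ?b ?P"
  proof (rule inj_onI, clarify)
    fix f g \<pi> \<rho>
    assume "f \<in> X \<rightarrow>\<^sub>E parity_group k" "g \<in> X \<rightarrow>\<^sub>E parity_group k" "\<pi> permutes X" "\<rho> permutes X"
      "branch (Suc (Suc k)) f \<pi> = branch (Suc (Suc k)) g \<rho>"
    then show "f = g \<and> \<pi> = \<rho>"
      using PiE_mono[of X "\<lambda>_. parity_group k" "\<lambda>_. carrier (tree_aut (Suc k))"] parity_group_subset
      by (intro branch_inject) blast+
  qed
  ultimately have "card (parity_group (Suc k)) = card ?P"
    using card_image[OF inj] by (simp only:)
  also have "\<dots> = (\<Sum>f\<in>X \<rightarrow>\<^sub>E parity_group k. card {\<pi>. \<pi> permutes X \<and> sign \<pi> = (\<Prod>i\<in>X. top_sign (f i))})"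
  proof (rule card_SigmaI)
    show "finite (X \<rightarrow>\<^sub>E parity_group k)"
      using finite_X finite_subset[OF parity_group_subset finite_tree_aut] by (rule finite_PiE)
    have "finite {\<pi>. \<pi> permutes X \<and> Q \<pi>}" for Q
      by (rule finite_subset[OF _ finite_permutations[OF finite_X]]) blast
    then show "\<forall>f\<in>X \<rightarrow>\<^sub>E parity_group k. finite {\<pi>. \<pi> permutes X \<and> sign \<pi> = (\<Prod>i\<in>X. top_sign (f i))}"
      by simp
  qed
  also have "\<dots> = (\<Sum>f\<in>X \<rightarrow>\<^sub>E parity_group k. 3)"
  proof (rule sum.cong[OF refl], rule card_permutes_X_sign)
    show "(\<Prod>i\<in>X. top_sign (f i)) = 1 \<or> (\<Prod>i\<in>X. top_sign (f i)) = - 1" for f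
      using top_sign_cases[of "f 0"] top_sign_cases[of "f 1"] top_sign_cases[of "f 2"] by (auto simp: X_def)
  qed
  also have "\<dots> = 3 * card (parity_group k) ^ 3"
    by (simp add: card_PiE finite_X card_X)
  finally show ?thesis .
qed

text \<open>Cubing triples both exponents, and the extra factor 3 adds one to the first: if
  \<open>m\<close> is half of \<open>3 ^ Suc k - 1\<close>, the next value is
  \<open>3 * m + 1\<close>.\<close>

lemma card_parity_group: "card (parity_group k) = 3 ^ ((3 ^ Suc k - 1) div 2) * 2 ^ (3 ^ k)"
proof (induction k)
  case 0
  then show ?case using card_parity_group_0 by simp
next
  case (Suc k)
  \<comment> \<open>Oddness of the power makes the division by 2 exact.\<close>
  have "odd (3 ^ Suc k :: nat)"
    by simp
  then obtain m where m: "(3 ^ Suc k :: nat) = 2 * m + 1"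
    by (rule oddE)
  then have "(3 ^ Suc (Suc k) :: nat) = 2 * (3 * m + 1) + 1"
    by simp
  then have e: "(3 ^ Suc (Suc k) - 1) div 2 = 3 * m + (1::nat)" "(3 ^ Suc k - 1) div 2 = m"
    using m by simp_all
  show ?case
    unfolding card_parity_group_Suc Suc.IH e
    by (simp add: power_mult_distrib mult.commute flip: power_mult)
qed

theorem theorem3p21:
  fixes n :: nat
  assumes "n \<ge> 1"
  shows "card (M n) = 3 ^ ((3 ^ n - 1) div 2) * 2 ^ (3 ^ (n - 1))"
proof -
  obtain k where "n = Suc k"
    using assms by (cases n) auto
  then show ?thesis
    using card_parity_group[of k] M_eq_parity_group[of k] by simp
qed

end
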